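(* Let $C_n$ ($n\ge 1$) be the Bethe cacti defined below. Then $M(C_1;x,y)=4x^2y^2$, and for every $n\ge 2$, $$M(C_n;x,y)=8\cdot 3^{n-2}x^2y^2+8\cdot 3^{n-2}x^2y^4+4(2\cdot 3^{n-2}-1)x^4y^4 .$$
   Context: For a finite simple graph $G$ and integers $i,j\ge 1$, let $m_{i,j}(G)$ be the number of edges $uv$ of $G$ with $\{d_u(G),d_v(G)\}=\{i,j\}$, where $d_v(G)$ is the degree of $v$. The $M$-polynomial of $G$ is $M(G;x,y)=\sum_{i\le j} m_{i,j}(G)\,x^iy^j$. Rooted Bethe cacti $D_n$: $D_1$ is a $4$-cycle with one designated vertex, its root. For $n\ge 2$, take a $4$-cycle with vertices $a,b,c,d$ in cyclic order, declare $a$ the root of $D_n$, and take three disjoint copies of $D_{n-1}$, identifying their roots with $b$, $c$, $d$ respectively. Bethe cacti $C_n$: $C_1$ is the $4$-cycle. For $n\ge 2$, $C_n$ is obtained from a $4$-cycle by taking four disjoint copies of $D_{n-1}$ and identifying the root of each copy with a different vertex of the $4$-cycle. *)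

theory Defs
  imports "HOL-Computational_Algebra.Polynomial"
begin

type_synonym 'a graph = "'a set \<times> 'a set set"

abbreviation verts :: "'a graph \<Rightarrow> 'a set" where "verts \<equiv> fst"
abbreviation edges :: "'a graph \<Rightarrow> 'a set set" where "edges \<equiv> snd"

definition finite_simple_graph :: "'a graph \<Rightarrow> bool" where
  "finite_simple_graph G \<longleftrightarrow>
     finite (verts G) \<and> (\<forall>e \<in> edges G. e \<subseteq> verts G \<and> card e = 2)"

definition degree_of :: "'a graph \<Rightarrow> 'a \<Rightarrow> nat" where
  "degree_of G v = card {e \<in> edges G. v \<in> e}"

definition edge_count :: "'a graph \<Rightarrow> nat \<Rightarrow> nat \<Rightarrow> nat" where
  "edge_count G i j =
     card {e \<in> edges G. \<exists>u v. e = {u, v} \<and> {degree_of G u, degree_of G v} = {i, j}}"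

text \<open>Bivariate integer polynomials are represented as polynomials in \<open>y\<close> whose
  coefficients are polynomials in \<open>x\<close>.\<close>

definition X :: "int poly poly" where "X = [:[:0, 1:]:]"
definition Y :: "int poly poly" where "Y = [:0, 1:]"

text \<open>The sum is restricted to the pairs with a nonzero coefficient, so that it is a finite
  sum for every finite simple graph (lemma \<open>finite_M_support\<close>).\<close>

definition M_polynomial :: "'a graph \<Rightarrow> int poly poly" where
  "M_polynomial G =
     (\<Sum>(i, j) \<in> {(i, j). 1 \<le> i \<and> i \<le> j \<and> edge_count G i j \<noteq> 0}.
        of_nat (edge_count G i j) * X ^ i * Y ^ j)"

lemma finite_M_support:
  assumes "finite_simple_graph G"
  shows "finite {(i, j). 1 \<le> i \<and> i \<le> j \<and> edge_count G i j \<noteq> 0}"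
proof (rule finite_subset)
  have "i \<in> degree_of G ` verts G \<and> j \<in> degree_of G ` verts G"
    if nz: "edge_count G i j \<noteq> 0" for i j
  proof -
    from nz have "{e \<in> edges G. \<exists>u v. e = {u, v} \<and> {degree_of G u, degree_of G v} = {i, j}} \<noteq> {}"
      unfolding edge_count_def by (metis (no_types, lifting) card.empty)
    then obtain u v where uv: "{u, v} \<in> edges G" "{degree_of G u, degree_of G v} = {i, j}"
      by blast
    from uv(1) assms have "u \<in> verts G" "v \<in> verts G"
      unfolding finite_simple_graph_def by blast+
    with uv(2) show ?thesis by (auto simp: doubleton_eq_iff)
  qed
  then show "{(i, j). 1 \<le> i \<and> i \<le> j \<and> edge_count G i j \<noteq> 0}
      \<subseteq> (degree_of G ` verts G) \<times> (degree_of G ` verts G)"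
    by auto
  show "finite ((degree_of G ` verts G) \<times> (degree_of G ` verts G))"
    using assms by (simp add: finite_simple_graph_def)
qed

definition four_cycle :: "'a \<Rightarrow> 'a \<Rightarrow> 'a \<Rightarrow> 'a \<Rightarrow> 'a graph" where
  "four_cycle a b c d = ({a, b, c, d}, {{a, b}, {b, c}, {c, d}, {d, a}})"

definition relabel :: "('a \<Rightarrow> 'b) \<Rightarrow> 'a graph \<Rightarrow> 'b graph" where
  "relabel f G = (f ` verts G, (\<lambda>e. f ` e) ` edges G)"

definition graph_union :: "'a graph \<Rightarrow> 'a graph \<Rightarrow> 'a graph"  (infixl "\<squnion>\<^sub>G" 65) where
  "G \<squnion>\<^sub>G H = (verts G \<union> verts H, edges G \<union> edges H)"

text \<open>Vertices are words over \<open>{0, 1, 2, 3}\<close>, and every rooted cactus \<open>D\<^sub>n\<close> has root \<open>[0]\<close>.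
  Prefixing all vertices with a letter \<open>k\<close> produces the \<open>k\<close>-th copy; copies with different
  letters are disjoint. Identifying the root of the \<open>k\<close>-th copy with a vertex of the new
  4-cycle is realised by using that root, \<open>[k, 0]\<close>, as the cycle vertex. The root \<open>[0]\<close> of the
  new rooted cactus belongs to none of the copies \<open>1, 2, 3\<close>. The index 0 is not meaningful.\<close>

definition root :: "nat list" where "root = [0]"

abbreviation copy :: "nat \<Rightarrow> nat list graph \<Rightarrow> nat list graph" where
  "copy k G \<equiv> relabel ((#) k) G"

fun rooted_bethe_cactus :: "nat \<Rightarrow> nat list graph" where
  "rooted_bethe_cactus 0 = ({}, {})"
| "rooted_bethe_cactus (Suc 0) = four_cycle root [1] [2] [3]"
| "rooted_bethe_cactus (Suc (Suc n)) =
     four_cycle root (1 # root) (2 # root) (3 # root)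
     \<squnion>\<^sub>G copy 1 (rooted_bethe_cactus (Suc n))
     \<squnion>\<^sub>G copy 2 (rooted_bethe_cactus (Suc n))
     \<squnion>\<^sub>G copy 3 (rooted_bethe_cactus (Suc n))"

fun bethe_cactus :: "nat \<Rightarrow> nat list graph" where
  "bethe_cactus 0 = ({}, {})"
| "bethe_cactus (Suc 0) = four_cycle [0] [1] [2] [3]"
| "bethe_cactus (Suc (Suc n)) =
     four_cycle (0 # root) (1 # root) (2 # root) (3 # root)
     \<squnion>\<^sub>G copy 0 (rooted_bethe_cactus (Suc n))
     \<squnion>\<^sub>G copy 1 (rooted_bethe_cactus (Suc n))
     \<squnion>\<^sub>G copy 2 (rooted_bethe_cactus (Suc n))
     \<squnion>\<^sub>G copy 3 (rooted_bethe_cactus (Suc n))"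

lemma finite_simple_four_cycle:
  "distinct [a, b, c, d] \<Longrightarrow> finite_simple_graph (four_cycle a b c d)"
  by (auto simp: finite_simple_graph_def four_cycle_def)

lemma finite_simple_union:
  "finite_simple_graph G \<Longrightarrow> finite_simple_graph H \<Longrightarrow> finite_simple_graph (G \<squnion>\<^sub>G H)"
  by (auto simp: finite_simple_graph_def graph_union_def)

lemma finite_simple_copy:
  "finite_simple_graph G \<Longrightarrow> finite_simple_graph (copy k G)"
  by (auto simp: finite_simple_graph_def relabel_def card_image)

lemma finite_simple_rooted_bethe_cactus: "finite_simple_graph (rooted_bethe_cactus n)"
proof (induction n rule: rooted_bethe_cactus.induct)
  case 1
  show ?case by (simp add: finite_simple_graph_def)
next
  case 2
  show ?case by (simp add: finite_simple_four_cycle root_def)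
next
  case (3 n)
  then show ?case
    by (simp add: finite_simple_union finite_simple_copy finite_simple_four_cycle root_def)
qed

lemma root_in_rooted_bethe_cactus: "n \<ge> 1 \<Longrightarrow> root \<in> verts (rooted_bethe_cactus n)"
  by (cases n rule: rooted_bethe_cactus.cases) (auto simp: graph_union_def four_cycle_def)

lemma finite_simple_bethe_cactus: "finite_simple_graph (bethe_cactus n)"
proof (cases n rule: bethe_cactus.cases)
  case 1
  then show ?thesis by (simp add: finite_simple_graph_def)
next
  case 2
  then show ?thesis by (simp add: finite_simple_four_cycle)
next
  case (3 m)
  then show ?thesis
    by (simp add: finite_simple_union finite_simple_copy finite_simple_four_cycle
        finite_simple_rooted_bethe_cactus root_def)
qed

end

theory Submission
  imports Defs
begin

text \<open>The \<open>M\<close>-polynomial is the sum over the edges \<open>uv\<close> of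
  \<open>x\<^bsup>min(d\<^sub>u, d\<^sub>v)\<^esup> y\<^bsup>max(d\<^sub>u, d\<^sub>v)\<^esup>\<close>. Inside a larger cactus, a copy of \<open>D\<^sub>n\<close> keeps
  its vertex degrees, except that its root gains 2 from the cycle through it. The edge sum of
  \<open>D\<^sub>n\<close> with respect to these shifted degrees satisfies a recursion: all edges of the new
  4-cycle contribute \<open>x\<^sup>4 y\<^sup>4\<close>, and the three copies of \<open>D\<^bsub>n-1\<^esub>\<close> contribute their own
  shifted sums.\<close>

definition edge_monomial :: "('a \<Rightarrow> nat) \<Rightarrow> 'a set \<Rightarrow> int poly poly" where
  "edge_monomial f e = X ^ Min (f ` e) * Y ^ Max (f ` e)"

definition edge_sum :: "('a \<Rightarrow> nat) \<Rightarrow> 'a graph \<Rightarrow> int poly poly" where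
  "edge_sum f G = (\<Sum>e \<in> edges G. edge_monomial f e)"

section \<open>The M-polynomial as a sum over edges\<close>

lemma finite_edges: "finite_simple_graph G \<Longrightarrow> finite (edges G)"
  unfolding finite_simple_graph_def by (meson Pow_iff finite_Pow_iff finite_subset subsetI)

lemma empty_notin_edges: "finite_simple_graph G \<Longrightarrow> {} \<notin> edges G"
  unfolding finite_simple_graph_def by fastforce

lemma edge_doubleton:
  assumes "finite_simple_graph G" "e \<in> edges G"
  obtains u v where "e = {u, v}" "u \<noteq> v"
  using assms unfolding finite_simple_graph_def by (metis card_2_iff)

lemma degree_of_pos:
  assumes "finite_simple_graph G" "e \<in> edges G" "v \<in> e"
  shows "degree_of G v \<ge> 1"
proof -
  have "card {e \<in> edges G. v \<in> e} \<noteq> 0"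
    using assms finite_edges[OF assms(1)] by auto
  then show ?thesis by (simp add: degree_of_def)
qed

lemma doubleton_eq_iff_Min_Max:
  fixes a b i j :: "'a::linorder"
  assumes "i \<le> j"
  shows "{a, b} = {i, j} \<longleftrightarrow> Min {a, b} = i \<and> Max {a, b} = j"
  using assms by (auto simp: doubleton_eq_iff min_def max_def split: if_splits)

lemma edge_count_eq:
  assumes "finite_simple_graph G" "i \<le> j"
  shows "edge_count G i j =
    card {e \<in> edges G. (Min (degree_of G ` e), Max (degree_of G ` e)) = (i, j)}"
proof -
  have "(\<exists>u v. e = {u, v} \<and> {degree_of G u, degree_of G v} = {i, j}) \<longleftrightarrow>
      (Min (degree_of G ` e), Max (degree_of G ` e)) = (i, j)" if "e \<in> edges G" for e
  proof -
    obtain u v where e: "e = {u, v}" using edge_doubleton[OF assms(1) \<open>e \<in> edges G\<close>] by metis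
    \<comment> \<open>The two ends of \<open>e\<close> are unique up to order, and the right-hand
      side is symmetric in \<open>i\<close> and \<open>j\<close>, so the existential depends only on
      the image of \<open>e\<close>.\<close>
    have "(\<exists>u' v'. e = {u', v'} \<and> {degree_of G u', degree_of G v'} = {i, j})
        \<longleftrightarrow> degree_of G ` e = {i, j}"
      using e by (auto simp: doubleton_eq_iff)
    then show ?thesis
      using doubleton_eq_iff_Min_Max[OF assms(2), of "degree_of G u" "degree_of G v"] e by simp
  qed
  then show ?thesis unfolding edge_count_def
    by (intro arg_cong[where f = card] Collect_cong conj_cong refl)
qed

text \<open>Group the edges by the pair \<open>h e\<close> of smaller and larger end degree. The
  fibre over \<open>(i, j)\<close> has \<open>edge_count G i j\<close> elements, all with the same
  monomial.\<close>

lemma M_polynomial_eq_edge_sum: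
  assumes G: "finite_simple_graph G"
  shows "M_polynomial G = edge_sum (degree_of G) G"
proof -
  define h where "h e = (Min (degree_of G ` e), Max (degree_of G ` e))" for e
  have fin: "finite (edges G)" by (rule finite_edges[OF G])
  have hE: "1 \<le> fst (h e) \<and> fst (h e) \<le> snd (h e)" if e: "e \<in> edges G" for e
  proof -
    obtain u v where "e = {u, v}" using edge_doubleton[OF G e] by metis
    with degree_of_pos[OF G e] show ?thesis by (auto simp: h_def)
  qed
  have count: "edge_count G i j = card {e \<in> edges G. h e = (i, j)}" if "i \<le> j" for i j
    using edge_count_eq[OF G that] by (simp add: h_def)
  \<comment> \<open>The bound \<open>1 \<le> i\<close> excludes no edge, because an end of an edge
    has positive degree.\<close>
  have supp: "{(i, j). 1 \<le> i \<and> i \<le> j \<and> edge_count G i j \<noteq> 0} = h ` edges G"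
  proof (intro set_eqI)
    fix p :: "nat \<times> nat"
    obtain i j where p: "p = (i, j)" by fastforce
    have "edge_count G i j \<noteq> 0 \<longleftrightarrow> p \<in> h ` edges G" if "i \<le> j"
    proof -
      have "p \<in> h ` edges G \<longleftrightarrow> {e \<in> edges G. h e = p} \<noteq> {}" by blast
      then show ?thesis using fin by (simp add: count[OF that] p)
    qed
    moreover have "1 \<le> i \<and> i \<le> j" if "p \<in> h ` edges G"
    proof -
      from that obtain e where "e \<in> edges G" "h e = (i, j)" unfolding p by force
      with hE[of e] show ?thesis by simp
    qed
    ultimately show "p \<in> {(i, j). 1 \<le> i \<and> i \<le> j \<and> edge_count G i j \<noteq> 0}
        \<longleftrightarrow> p \<in> h ` edges G"
      by (auto simp: p)
  qed
  have "edge_sum (degree_of G) G =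
      (\<Sum>p \<in> h ` edges G. \<Sum>e \<in> {e \<in> edges G. h e = p}. edge_monomial (degree_of G) e)"
    unfolding edge_sum_def by (rule sum.image_gen[OF fin])
  also have "\<dots> = (\<Sum>(i, j) \<in> h ` edges G. of_nat (edge_count G i j) * X ^ i * Y ^ j)"
  proof (rule sum.cong[OF refl])
    fix p assume p: "p \<in> h ` edges G"
    obtain i j where ij: "p = (i, j)" by fastforce
    with p obtain e' where "e' \<in> edges G" "h e' = (i, j)" by force
    with hE[of e'] have "i \<le> j" by simp
    have "(\<Sum>e \<in> {e \<in> edges G. h e = p}. edge_monomial (degree_of G) e)
        = (\<Sum>e \<in> {e \<in> edges G. h e = p}. X ^ i * Y ^ j)"
      by (rule sum.cong) (auto simp: edge_monomial_def h_def ij)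
    also have "\<dots> = of_nat (edge_count G i j) * X ^ i * Y ^ j"
      by (simp add: count[OF \<open>i \<le> j\<close>] ij mult.assoc)
    finally show "(\<Sum>e \<in> {e \<in> edges G. h e = p}. edge_monomial (degree_of G) e) =
        (case p of (i, j) \<Rightarrow> of_nat (edge_count G i j) * X ^ i * Y ^ j)"
      by (simp add: ij)
  qed
  finally show ?thesis unfolding M_polynomial_def supp by simp
qed

section \<open>Degrees and edge sums of unions, copies and 4-cycles\<close>

text \<open>Only the edge sets have to be disjoint: the graphs may share vertices, and at a vertex
  where they are glued the degrees add.\<close>

lemma degree_of_union:
  assumes "finite (edges G)" "finite (edges H)" "edges G \<inter> edges H = {}"
  shows "degree_of (G \<squnion>\<^sub>G H) v = degree_of G v + degree_of H v"
proof -
  have "{e \<in> edges (G \<squnion>\<^sub>G H). v \<in> e} = {e \<in> edges G. v \<in> e} \<union> {e \<in> edges H. v \<in> e}"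
    by (auto simp: graph_union_def)
  then show ?thesis
    unfolding degree_of_def using assms by (simp add: card_Un_disjoint disjoint_iff)
qed

lemma edge_sum_union:
  assumes "finite (edges G)" "finite (edges H)" "edges G \<inter> edges H = {}"
  shows "edge_sum f (G \<squnion>\<^sub>G H) = edge_sum f G + edge_sum f H"
  using assms by (simp add: edge_sum_def graph_union_def sum.union_disjoint)

lemma degree_of_relabel:
  assumes "inj f"
  shows "degree_of (relabel f G) (f v) = degree_of G v"
proof -
  have "{e \<in> edges (relabel f G). f v \<in> e} = (`) f ` {e \<in> edges G. v \<in> e}"
    using assms by (auto simp: relabel_def dest: injD)
  moreover have "inj_on ((`) f) {e \<in> edges G. v \<in> e}"
    by (simp add: inj_on_def inj_image_eq_iff[OF assms])
  ultimately show ?thesis by (simp add: degree_of_def card_image)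
qed

lemma degree_of_relabel_notin: "v \<notin> range f \<Longrightarrow> degree_of (relabel f G) v = 0"
proof -
  assume "v \<notin> range f"
  then have "{e \<in> edges (relabel f G). v \<in> e} = {}" by (auto simp: relabel_def)
  then show ?thesis unfolding degree_of_def by (metis card.empty)
qed

text \<open>The weight \<open>g\<close> is arbitrary because copies are later weighted by degrees
  taken in the larger cactus, not by their own.\<close>

lemma edge_sum_relabel:
  assumes "inj f"
  shows "edge_sum g (relabel f G) = edge_sum (\<lambda>v. g (f v)) G"
proof -
  have "inj_on ((`) f) (edges G)" by (simp add: inj_on_def inj_image_eq_iff[OF assms])
  then show ?thesis
    by (simp add: edge_sum_def relabel_def sum.reindex edge_monomial_def image_image)
qed

lemma degree_of_copy:
  "degree_of (copy k G) w = (case w of [] \<Rightarrow> 0 | l # v \<Rightarrow> if l = k then degree_of G v else 0)"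
proof (cases "w \<in> range ((#) k)")
  case True
  then show ?thesis by (auto simp: degree_of_relabel)
next
  case False
  then show ?thesis by (auto simp: degree_of_relabel_notin split: list.split)
qed

lemma edge_sum_copy: "edge_sum g (copy k G) = edge_sum (\<lambda>v. g (k # v)) G"
  by (simp add: edge_sum_relabel)

lemma edges_four_cycle_distinct:
  "distinct [a, b, c, d] \<Longrightarrow> distinct [{a, b}, {b, c}, {c, d}, {d, a}]"
  by (auto simp: doubleton_eq_iff)

lemma finite_edges_four_cycle: "finite (edges (four_cycle a b c d))"
  by (simp add: four_cycle_def)

lemma degree_of_four_cycle:
  assumes "distinct [a, b, c, d]"
  shows "degree_of (four_cycle a b c d) v = (if v \<in> {a, b, c, d} then 2 else 0)"
proof -
  \<comment> \<open>Counting by indicators lets the sum run over the four explicit edges; they are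
    pairwise distinct, so none is lost in the set.\<close>
  have "degree_of (four_cycle a b c d) v = (\<Sum>e \<in> edges (four_cycle a b c d). if v \<in> e then 1 else 0)"
    unfolding degree_of_def by (simp add: finite_edges_four_cycle sum.If_cases Int_def)
  also have "\<dots> = (if v \<in> {a, b, c, d} then 2 else 0)"
    using assms edges_four_cycle_distinct[OF assms] by (auto simp: four_cycle_def)
  finally show ?thesis .
qed

lemma edge_sum_four_cycle:
  assumes "distinct [a, b, c, d]"
  shows "edge_sum f (four_cycle a b c d) = edge_monomial f {a, b} + edge_monomial f {b, c}
    + edge_monomial f {c, d} + edge_monomial f {d, a}"
  using edges_four_cycle_distinct[OF assms] by (simp add: edge_sum_def four_cycle_def add.assoc)

lemma edges_copy_hd: "e \<in> edges (copy k G) \<Longrightarrow> x \<in> e \<Longrightarrow> hd x = k"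
  by (auto simp: relabel_def)

lemma edges_copy_disjoint:
  assumes "finite_simple_graph G" "k \<noteq> l"
  shows "edges (copy k G) \<inter> edges (copy l H) = {}"
proof -
  have "e \<noteq> {}" if "e \<in> edges (copy k G)" for e
    using that empty_notin_edges[OF assms(1)] by (auto simp: relabel_def)
  then show ?thesis using assms(2) edges_copy_hd by (metis disjoint_iff ex_in_conv)
qed

lemma edges_four_cycle_copy_disjoint:
  assumes "distinct (map hd [a, b, c, d])"
  shows "edges (four_cycle a b c d) \<inter> edges (copy k G) = {}"
proof -
  have "\<exists>x \<in> e. hd x \<noteq> k" if "e \<in> edges (four_cycle a b c d)" for e
    using that assms by (auto simp: four_cycle_def)
  then show ?thesis using edges_copy_hd by (metis disjoint_iff)
qed

definition shifted_degree :: "nat list graph \<Rightarrow> nat list \<Rightarrow> nat" where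
  "shifted_degree G v = degree_of G v + (if v = root then 2 else 0)"

lemma rooted_bethe_cactus_step:
  fixes n
  defines "D \<equiv> rooted_bethe_cactus (Suc n)"
  defines "D' \<equiv> rooted_bethe_cactus (Suc (Suc n))"
  shows degree_of_rooted_bethe_cactus_root: "degree_of D' root = 2"
    and degree_of_rooted_bethe_cactus_copy:
      "k \<in> {1, 2, 3} \<Longrightarrow> degree_of D' (k # v) = shifted_degree D v"
    and edge_sum_rooted_bethe_cactus:
      "edge_sum f D' = edge_sum f (four_cycle root (1 # root) (2 # root) (3 # root))
        + (\<Sum>k\<in>{1, 2, 3}. edge_sum (\<lambda>v. f (k # v)) D)"
proof -
  let ?C = "four_cycle root (1 # root) (2 # root) (3 # root)"
  have D': "D' = ?C \<squnion>\<^sub>G copy 1 D \<squnion>\<^sub>G copy 2 D \<squnion>\<^sub>G copy 3 D"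
    by (simp add: D_def D'_def)
  have fs: "finite_simple_graph D" by (simp add: D_def finite_simple_rooted_bethe_cactus)
  have fin: "finite (edges (copy k D))" for k
    using fs by (intro finite_edges finite_simple_copy)
  have disC: "edges ?C \<inter> edges (copy k D) = {}" for k
    by (rule edges_four_cycle_copy_disjoint) (simp add: root_def)
  have union: "edges (G \<squnion>\<^sub>G H) = edges G \<union> edges H" for G H :: "nat list graph"
    by (simp add: graph_union_def)
  note simps = fin disC union finite_edges_four_cycle Int_Un_distrib2
    edges_copy_disjoint[OF fs]
  have deg: "degree_of D' v = degree_of ?C v + degree_of (copy 1 D) v
      + degree_of (copy 2 D) v + degree_of (copy 3 D) v" for v
    unfolding D' by (simp add: degree_of_union simps del: One_nat_def)
  show "degree_of D' root = 2"
    by (simp add: deg degree_of_four_cycle degree_of_copy root_def)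
  show "degree_of D' (k # v) = shifted_degree D v" if "k \<in> {1, 2, 3}"
    using that by (auto simp: deg degree_of_four_cycle degree_of_copy shifted_degree_def root_def)
  show "edge_sum f D' = edge_sum f ?C + (\<Sum>k\<in>{1, 2, 3}. edge_sum (\<lambda>v. f (k # v)) D)"
    unfolding D' by (simp add: edge_sum_union edge_sum_copy simps del: One_nat_def)
qed

lemma bethe_cactus_step:
  fixes n
  defines "D \<equiv> rooted_bethe_cactus (Suc n)"
  defines "C \<equiv> bethe_cactus (Suc (Suc n))"
  shows degree_of_bethe_cactus_copy:
      "k \<in> {0, 1, 2, 3} \<Longrightarrow> degree_of C (k # v) = shifted_degree D v"
    and edge_sum_bethe_cactus:
      "edge_sum f C = edge_sum f (four_cycle (0 # root) (1 # root) (2 # root) (3 # root))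
        + (\<Sum>k\<in>{0, 1, 2, 3}. edge_sum (\<lambda>v. f (k # v)) D)"
proof -
  let ?C = "four_cycle (0 # root) (1 # root) (2 # root) (3 # root)"
  have C: "C = ?C \<squnion>\<^sub>G copy 0 D \<squnion>\<^sub>G copy 1 D \<squnion>\<^sub>G copy 2 D \<squnion>\<^sub>G copy 3 D"
    by (simp add: D_def C_def)
  have fs: "finite_simple_graph D" by (simp add: D_def finite_simple_rooted_bethe_cactus)
  have fin: "finite (edges (copy k D))" for k
    using fs by (intro finite_edges finite_simple_copy)
  have disC: "edges ?C \<inter> edges (copy k D) = {}" for k
    by (rule edges_four_cycle_copy_disjoint) simp
  have union: "edges (G \<squnion>\<^sub>G H) = edges G \<union> edges H" for G H :: "nat list graph"
    by (simp add: graph_union_def)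
  note simps = fin disC union finite_edges_four_cycle Int_Un_distrib2
    edges_copy_disjoint[OF fs]
  have deg: "degree_of C v = degree_of ?C v + degree_of (copy 0 D) v + degree_of (copy 1 D) v
      + degree_of (copy 2 D) v + degree_of (copy 3 D) v" for v
    unfolding C by (simp add: degree_of_union simps del: One_nat_def)
  show "degree_of C (k # v) = shifted_degree D v" if "k \<in> {0, 1, 2, 3}"
    using that by (auto simp: deg degree_of_four_cycle degree_of_copy shifted_degree_def root_def)
  show "edge_sum f C = edge_sum f ?C + (\<Sum>k\<in>{0, 1, 2, 3}. edge_sum (\<lambda>v. f (k # v)) D)"
    unfolding C by (simp add: edge_sum_union edge_sum_copy simps del: One_nat_def)
qed

lemma degree_of_root: "degree_of (rooted_bethe_cactus (Suc n)) root = 2"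
proof (cases n)
  case 0
  then show ?thesis by (simp add: degree_of_four_cycle root_def)
next
  case (Suc m)
  then show ?thesis using degree_of_rooted_bethe_cactus_root by simp
qed

lemma shifted_degree_root: "shifted_degree (rooted_bethe_cactus (Suc n)) root = 4"
  by (simp add: shifted_degree_def degree_of_root)

lemma edge_sum_shifted_degree:
  "edge_sum (shifted_degree (rooted_bethe_cactus (Suc n))) (rooted_bethe_cactus (Suc n)) =
    2 * 3 ^ n * X ^ 2 * Y ^ 2 + 2 * 3 ^ n * X ^ 2 * Y ^ 4 + 2 * (3 ^ n - 1) * X ^ 4 * Y ^ 4"
proof (induction n)
  case 0
  show ?case
    by (simp add: edge_sum_four_cycle edge_monomial_def shifted_degree_def degree_of_four_cycle
        root_def power2_eq_square)
next
  case (Suc n)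
  let ?D = "rooted_bethe_cactus (Suc n)" and ?D' = "rooted_bethe_cactus (Suc (Suc n))"
  let ?f = "shifted_degree ?D'"
  have f: "?f (k # v) = shifted_degree ?D v" if "k \<in> {1, 2, 3}" for k v
    using that degree_of_rooted_bethe_cactus_copy[OF that, of n v]
    by (auto simp: shifted_degree_def root_def)
  have "edge_sum ?f (four_cycle root (1 # root) (2 # root) (3 # root)) = 4 * X ^ 4 * Y ^ 4"
  proof (subst edge_sum_four_cycle)
    show "distinct [root, 1 # root, 2 # root, 3 # root]" by (simp add: root_def)
  qed (simp add: edge_monomial_def f shifted_degree_root del: rooted_bethe_cactus.simps)
  moreover have "(\<Sum>k\<in>{1, 2, 3}. edge_sum (\<lambda>v. ?f (k # v)) ?D)
      = 3 * edge_sum (shifted_degree ?D) ?D"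
    by (simp add: f del: rooted_bethe_cactus.simps)
  ultimately show ?case
    unfolding edge_sum_rooted_bethe_cactus[of ?f] Suc.IH by (simp add: algebra_simps)
qed

theorem theorem3p2:
  "M_polynomial (bethe_cactus 1) = 4 * X ^ 2 * Y ^ 2 \<and>
   (\<forall>n::nat. n \<ge> 2 \<longrightarrow>
      M_polynomial (bethe_cactus n) =
        8 * 3 ^ (n - 2) * X ^ 2 * Y ^ 2
        + 8 * 3 ^ (n - 2) * X ^ 2 * Y ^ 4
        + 4 * (2 * 3 ^ (n - 2) - 1) * X ^ 4 * Y ^ 4)"
proof (intro conjI allI impI)
  show "M_polynomial (bethe_cactus 1) = 4 * X ^ 2 * Y ^ 2"
    unfolding M_polynomial_eq_edge_sum[OF finite_simple_bethe_cactus]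
    by (simp add: edge_sum_four_cycle edge_monomial_def degree_of_four_cycle)
next
  fix n :: nat assume "n \<ge> 2"
  then obtain m where n: "n = Suc (Suc m)" by (metis add_2_eq_Suc le_Suc_ex)
  let ?D = "rooted_bethe_cactus (Suc m)" and ?C = "bethe_cactus (Suc (Suc m))"
  let ?f = "degree_of ?C"
  note f = degree_of_bethe_cactus_copy[of _ m]
  have "edge_sum ?f (four_cycle (0 # root) (1 # root) (2 # root) (3 # root)) = 4 * X ^ 4 * Y ^ 4"
    by (subst edge_sum_four_cycle)
      (simp_all add: edge_monomial_def f shifted_degree_root
        del: rooted_bethe_cactus.simps bethe_cactus.simps)
  moreover have "(\<Sum>k\<in>{0, 1, 2, 3}. edge_sum (\<lambda>v. ?f (k # v)) ?D)
      = 4 * edge_sum (shifted_degree ?D) ?D"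
    by (simp add: f del: rooted_bethe_cactus.simps bethe_cactus.simps)
  ultimately show "M_polynomial (bethe_cactus n) =
        8 * 3 ^ (n - 2) * X ^ 2 * Y ^ 2
        + 8 * 3 ^ (n - 2) * X ^ 2 * Y ^ 4
        + 4 * (2 * 3 ^ (n - 2) - 1) * X ^ 4 * Y ^ 4"
    unfolding n M_polynomial_eq_edge_sum[OF finite_simple_bethe_cactus]
      edge_sum_bethe_cactus[of ?f] edge_sum_shifted_degree
    by (simp add: algebra_simps)
qed

end
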